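(* Let $\alpha\ge 0$. Then $\mathcal{W}^0_{\mathcal{H}}(\alpha)$ is a subclass of $\mathcal{C}^0_{\mathcal{H}}$; that is, every $f\in\mathcal{W}^0_{\mathcal{H}}(\alpha)$ is a harmonic close-to-convex mapping in $\mathbb{D}$ with $f_{\overline{z}}(0)=0$.
   Context: $\mathbb{D}=\{z\in\mathbb{C}:|z|<1\}$. $\mathcal{H}$ is the class of complex-valued harmonic functions $f$ in $\mathbb{D}$ with $f(0)=0$ and $f_z(0)=1$; each has the canonical representation $f=h+\overline{g}$ with $h(z)=z+\sum_{n\ge2}a_nz^n$ and $g(z)=\sum_{n\ge1}b_nz^n$ analytic in $\mathbb{D}$. For $\alpha\ge0$, $\mathcal{W}^0_{\mathcal{H}}(\alpha)$ is the class of $f=h+\overline{g}\in\mathcal{H}$ with $g'(0)=0$ and $\mathrm{Re}(h'(z)+\alpha zh''(z))>|g'(z)+\alpha zg''(z)|$ for all $z\in\mathbb{D}$. A domain is close-to-convex if its complement can be written as a union of non-intersecting half lines. A function $f\in\mathcal{H}$ is called close-to-convex in $\mathbb{D}$ if $f(\mathbb{D})$ is a close-to-convex domain; $\mathcal{C}^0_{\mathcal{H}}$ is the class of harmonic close-to-convex mappings $f\in\mathcal{H}$ with $f_{\overline{z}}(0)=0$. *)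

theory Defs
  imports "HOL-Complex_Analysis.Complex_Analysis"
begin

abbreviation unit_disk :: "complex set"
  where "unit_disk \<equiv> ball 0 1"

definition partial_x :: "(complex \<Rightarrow> complex) \<Rightarrow> complex \<Rightarrow> complex"
  where "partial_x f z = vector_derivative (\<lambda>t. f (z + of_real t)) (at 0)"

definition partial_y :: "(complex \<Rightarrow> complex) \<Rightarrow> complex \<Rightarrow> complex"
  where "partial_y f z = vector_derivative (\<lambda>t. f (z + \<i> * of_real t)) (at 0)"

definition wirtinger :: "(complex \<Rightarrow> complex) \<Rightarrow> complex \<Rightarrow> complex"
  where "wirtinger f z = (partial_x f z - \<i> * partial_y f z) / 2"

definition wirtinger_bar :: "(complex \<Rightarrow> complex) \<Rightarrow> complex \<Rightarrow> complex"
  where "wirtinger_bar f z = (partial_x f z + \<i> * partial_y f z) / 2"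

(* "differentiable_on" is real (Frechet) differentiability. It guarantees that the partial
   derivatives, total functions here, are genuine ones on the open set S. *)
definition C2_on :: "complex set \<Rightarrow> (complex \<Rightarrow> complex) \<Rightarrow> bool"
  where "C2_on S f \<longleftrightarrow>
    f differentiable_on S \<and> partial_x f differentiable_on S \<and> partial_y f differentiable_on S \<and>
    continuous_on S (partial_x (partial_x f)) \<and> continuous_on S (partial_x (partial_y f)) \<and>
    continuous_on S (partial_y (partial_x f)) \<and> continuous_on S (partial_y (partial_y f))"

definition harmonic_on :: "complex set \<Rightarrow> (complex \<Rightarrow> complex) \<Rightarrow> bool"
  where "harmonic_on S f \<longleftrightarrow>
    C2_on S f \<and> (\<forall>z\<in>S. partial_x (partial_x f) z + partial_y (partial_y f) z = 0)"

definition class_H :: "(complex \<Rightarrow> complex) set"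
  where "class_H = {f. harmonic_on unit_disk f \<and> f 0 = 0 \<and> wirtinger f 0 = 1}"

(* h(z) = z + sum_{n >= 2} a_n z^n and g(z) = sum_{n >= 1} b_n z^n on the unit disk.
   The values of functions outside the disk play no role. *)
definition canonical_rep ::
    "(complex \<Rightarrow> complex) \<Rightarrow> (complex \<Rightarrow> complex) \<Rightarrow> (complex \<Rightarrow> complex) \<Rightarrow> bool"
  where "canonical_rep f h g \<longleftrightarrow>
    h holomorphic_on unit_disk \<and> h 0 = 0 \<and> deriv h 0 = 1 \<and>
    g holomorphic_on unit_disk \<and> g 0 = 0 \<and>
    (\<forall>z\<in>unit_disk. f z = h z + cnj (g z))"

definition class_W0 :: "real \<Rightarrow> (complex \<Rightarrow> complex) set"
  where "class_W0 \<alpha> = {f \<in> class_H. \<exists>h g. canonical_rep f h g \<and> deriv g 0 = 0 \<and>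
    (\<forall>z\<in>unit_disk. Re (deriv h z + of_real \<alpha> * z * deriv (deriv h) z)
                   > cmod (deriv g z + of_real \<alpha> * z * deriv (deriv g) z))}"

definition half_line :: "complex set \<Rightarrow> bool"
  where "half_line L \<longleftrightarrow> (\<exists>a d. d \<noteq> 0 \<and> L = {a + of_real t * d | t. t \<ge> 0})"

(* Half lines contain their end point, and distinct ones in the family are disjoint,
   end points included. *)
definition close_to_convex_domain :: "complex set \<Rightarrow> bool"
  where "close_to_convex_domain U \<longleftrightarrow> open U \<and> connected U \<and> U \<noteq> {} \<and>
    (\<exists>\<L>. (\<forall>L\<in>\<L>. half_line L) \<and> pairwise disjnt \<L> \<and> - U = \<Union>\<L>)"

definition close_to_convex :: "(complex \<Rightarrow> complex) \<Rightarrow> bool"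
  where "close_to_convex f \<longleftrightarrow> f \<in> class_H \<and> close_to_convex_domain (f ` unit_disk)"

definition class_C0 :: "(complex \<Rightarrow> complex) set"
  where "class_C0 = {f. close_to_convex f \<and> wirtinger_bar f 0 = 0}"

end

theory Submission
  imports Defs
begin

text \<open>
  Integrating along rays from \<open>0\<close> turns the hypothesis into \<open>Re h' > |g'|\<close>, and integrating along
  chords then makes \<open>f = h + cnj g\<close> strictly monotone: \<open>(f x - f y) \<bullet> (x - y) > 0\<close> for \<open>x \<noteq> y\<close>.
  Put \<open>A z = {w. \<forall>u. (w - f u) \<bullet> (z - u) \<ge> 0}\<close> for \<open>|z| \<le> 1\<close>, with \<open>u\<close> ranging over the open disk.
  By Brouwer's theorem and compactness every \<open>w\<close> lies in some \<open>A z\<close> (Minty). For \<open>|z| < 1\<close>,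
  \<open>A z = {f z}\<close>, so the complement of the image is the union of the sets \<open>A z\<close> with \<open>|z| = 1\<close>.
  These are pairwise disjoint, and \<open>A z\<close> is cut out by inequalities whose left-hand sides
  strictly increase in the direction \<open>z\<close>; so every line parallel to \<open>z\<close> meets it in nothing or in a
  closed half line.
\<close>

section \<open>Monotone maps and their extension to boundary points\<close>

definition strictly_monotone_on :: "'a::real_inner set \<Rightarrow> ('a \<Rightarrow> 'a) \<Rightarrow> bool"
  where "strictly_monotone_on S f \<longleftrightarrow> (\<forall>x\<in>S. \<forall>y\<in>S. x \<noteq> y \<longrightarrow> (f x - f y) \<bullet> (x - y) > 0)"

text \<open>These are the values at \<open>z\<close> that are monotonically related to the whole
  graph of \<open>f\<close> over \<open>S\<close>. The point \<open>z\<close> need not lie in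
  \<open>S\<close>, which is how boundary points of the ball receive values.\<close>

definition minty_set :: "'a::real_inner set \<Rightarrow> ('a \<Rightarrow> 'a) \<Rightarrow> 'a \<Rightarrow> 'a set"
  where "minty_set S f z = {w. \<forall>u\<in>S. (w - f u) \<bullet> (z - u) \<ge> 0}"

lemma strictly_monotone_onD:
  "strictly_monotone_on S f \<Longrightarrow> x \<in> S \<Longrightarrow> y \<in> S \<Longrightarrow> x \<noteq> y \<Longrightarrow> (f x - f y) \<bullet> (x - y) > 0"
  by (simp add: strictly_monotone_on_def)

lemma minty_setD: "w \<in> minty_set S f z \<Longrightarrow> u \<in> S \<Longrightarrow> (w - f u) \<bullet> (z - u) \<ge> 0"
  by (simp add: minty_set_def)

lemma strictly_monotone_on_imp_monotone:
  "strictly_monotone_on S f \<Longrightarrow> x \<in> S \<Longrightarrow> y \<in> S \<Longrightarrow> (f x - f y) \<bullet> (x - y) \<ge> 0"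
  by (cases "x = y") (auto dest: strictly_monotone_onD intro: less_imp_le)

lemma strictly_monotone_on_imp_inj_on:
  assumes "strictly_monotone_on S f"
  shows "inj_on f S"
proof (rule inj_onI, rule ccontr)
  fix x y assume "x \<in> S" "y \<in> S" "f x = f y" "x \<noteq> y"
  with strictly_monotone_onD[OF assms, of x y] show False by simp
qed

section \<open>Existence: Brouwer's theorem and Minty's theorem\<close>

text \<open>By Brouwer, projecting \<open>x - f x\<close> onto \<open>K\<close> has a fixed point
  \<open>z\<close>. The obtuse angle property of the projection of \<open>z - f z\<close> is the
  claimed inequality.\<close>

lemma variational_inequality:
  fixes f :: "'a::euclidean_space \<Rightarrow> 'a"
  assumes "compact K" "convex K" "K \<noteq> {}" "continuous_on K f"
  obtains z where "z \<in> K" "\<And>u. u \<in> K \<Longrightarrow> f z \<bullet> (u - z) \<ge> 0"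
proof -
  define T where "T x = closest_point K (x - f x)" for x
  have "closed K" using assms by (simp add: compact_imp_closed)
  have "continuous_on K (closest_point K \<circ> (\<lambda>x. x - f x))"
    using assms \<open>closed K\<close>
    by (intro continuous_on_compose continuous_intros continuous_on_closest_point)
  then have "continuous_on K T" by (simp add: T_def o_def)
  moreover have "T \<in> K \<rightarrow> K"
    using \<open>closed K\<close> assms by (auto simp: T_def closest_point_in_set)
  ultimately obtain z where z: "z \<in> K" "T z = z"
    using brouwer[of K T] assms by blast
  have "f z \<bullet> (u - z) \<ge> 0" if "u \<in> K" for u
    using closest_point_dot[OF \<open>convex K\<close> \<open>closed K\<close> that, of "z - f z"] z
    by (simp add: T_def)
  with z that show thesis by blast
qed

text \<open>Since \<open>f\<close> is controlled only on the open ball, the variational inequality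
  for \<open>f - w\<close> is solved on the closed balls of radius \<open>r n < 1\<close>, and a
  limit point of the solutions is taken.\<close>

lemma minty_set_surj:
  fixes f :: "'a::euclidean_space \<Rightarrow> 'a"
  assumes cont: "continuous_on (ball 0 1) f" and mono: "strictly_monotone_on (ball 0 1) f"
  obtains z where "z \<in> cball 0 1" "w \<in> minty_set (ball 0 1) f z"
proof -
  define r where "r n = 1 - inverse (real (Suc n))" for n
  have r: "0 \<le> r n" "r n < 1" for n by (auto simp: r_def field_simps)
  have "\<exists>z\<in>cball 0 (r n). \<forall>u\<in>cball 0 (r n). (w - f u) \<bullet> (z - u) \<ge> 0" for n
  proof -
    have sub: "cball 0 (r n) \<subseteq> (ball 0 1 :: 'a set)" using r[of n] by auto
    have "continuous_on (cball 0 (r n)) (\<lambda>x. f x - w)"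
      using continuous_on_subset[OF cont sub] by (intro continuous_intros)
    then obtain z where z: "z \<in> cball 0 (r n)"
        and vi: "\<And>u. u \<in> cball 0 (r n) \<Longrightarrow> (f z - w) \<bullet> (u - z) \<ge> 0"
      using variational_inequality[of "cball 0 (r n)" "\<lambda>x. f x - w"] r[of n] by auto
    have "(w - f u) \<bullet> (z - u) \<ge> 0" if u: "u \<in> cball 0 (r n)" for u
    proof -
      \<comment> \<open>Minty's trick: monotonicity replaces \<open>f z\<close> by
        \<open>f u\<close>. The resulting inequality is affine in \<open>z\<close>, so it passes to
        a limit on the sphere, where \<open>f\<close> need not be continuous.\<close>
      have "(f u - f z) \<bullet> (u - z) \<ge> 0"
        using strictly_monotone_on_imp_monotone[OF mono] u z sub by blast
      with vi[OF u] show ?thesis by (simp add: inner_simps)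
    qed
    with z show ?thesis by blast
  qed
  then obtain z where z: "\<And>n. z n \<in> cball 0 (r n)"
    and ineq: "\<And>n u. u \<in> cball 0 (r n) \<Longrightarrow> (w - f u) \<bullet> (z n - u) \<ge> 0"
    by metis
  have "z n \<in> cball 0 1" for n using z[of n] r(2)[of n] by auto
  then obtain l s where l: "l \<in> cball 0 1" "strict_mono s" "(z \<circ> s) \<longlonglongrightarrow> l"
    using compact_cball[of "0::'a" 1] unfolding compact_def by metis
  have "(w - f u) \<bullet> (l - u) \<ge> 0" if u: "u \<in> ball 0 1" for u
  proof -
    have "r \<longlonglongrightarrow> 1"
      unfolding r_def using tendsto_diff[OF tendsto_const LIMSEQ_inverse_real_of_nat, of 1] by simp
    then have "(\<lambda>n. r (s n)) \<longlonglongrightarrow> 1"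
      using LIMSEQ_subseq_LIMSEQ[OF _ l(2), of r 1] by (simp add: o_def)
    then have "\<forall>\<^sub>F n in sequentially. norm u < r (s n)"
      using u by (intro order_tendstoD) auto
    then have "\<forall>\<^sub>F n in sequentially. (w - f u) \<bullet> (z (s n) - u) \<ge> 0"
      by eventually_elim (use ineq in auto)
    moreover have "(\<lambda>n. (w - f u) \<bullet> (z (s n) - u)) \<longlonglongrightarrow> (w - f u) \<bullet> (l - u)"
      using l(3) by (intro tendsto_intros) (simp add: o_def)
    ultimately show ?thesis
      by (intro tendsto_lowerbound) auto
  qed
  with l(1) that show thesis by (auto simp: minty_set_def)
qed

section \<open>Interior points, boundary points and disjointness\<close>

text \<open>Testing with \<open>u = z + s v\<close> for \<open>v = w - f z\<close> and small
  \<open>s > 0\<close> gives \<open>(w - f u) \<bullet> v \<le> 0\<close>. As \<open>s\<close> tends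
  to 0, continuity turns this into \<open>v \<bullet> v \<le> 0\<close>.\<close>

lemma minty_set_interior:
  fixes f :: "'a::euclidean_space \<Rightarrow> 'a"
  assumes cont: "continuous_on S f" and "open S" and z: "z \<in> S" and w: "w \<in> minty_set S f z"
  shows "w = f z"
proof -
  define v where "v = w - f z"
  define u where "u n = z + inverse (real (Suc n)) *\<^sub>R v" for n
  have u: "u \<longlonglongrightarrow> z"
    unfolding u_def
    using tendsto_add[OF tendsto_const tendsto_scaleR[OF LIMSEQ_inverse_real_of_nat tendsto_const], of z v]
    by simp
  have "\<forall>\<^sub>F n in sequentially. u n \<in> S"
    using topological_tendstoD[OF u \<open>open S\<close> z] .
  then have "\<forall>\<^sub>F n in sequentially. (w - f (u n)) \<bullet> v \<le> 0"
  proof eventually_elim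
    case (elim n)
    from minty_setD[OF w elim] have "inverse (real (Suc n)) * ((w - f (u n)) \<bullet> v) \<le> 0"
      by (simp add: u_def)
    then show ?case by (simp add: mult_le_0_iff field_simps)
  qed
  moreover have "(\<lambda>n. (w - f (u n)) \<bullet> v) \<longlonglongrightarrow> (w - f z) \<bullet> v"
    using u cont \<open>open S\<close> z
    by (intro tendsto_intros isCont_tendsto_compose[of z f]) (auto simp: continuous_on_eq_continuous_at)
  ultimately have "(w - f z) \<bullet> v \<le> 0"
    by (intro tendsto_upperbound) auto
  then have "v = 0" using inner_gt_zero_iff[of v] by (simp add: v_def[symmetric] flip: not_less)
  then show ?thesis by (simp add: v_def)
qed

text \<open>If \<open>w = f x\<close>, test with the midpoint \<open>u\<close> of \<open>x\<close>
  and \<open>z\<close>: since \<open>z - u = u - x\<close>, the defining inequality at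
  \<open>u\<close> contradicts strict monotonicity between \<open>u\<close> and
  \<open>x\<close>.\<close>

lemma minty_set_boundary_disjoint_image:
  fixes f :: "'a::euclidean_space \<Rightarrow> 'a"
  assumes mono: "strictly_monotone_on (ball 0 1) f"
    and z: "norm z = 1" and w: "w \<in> minty_set (ball 0 1) f z"
  shows "w \<notin> f ` ball 0 1"
proof
  assume "w \<in> f ` ball 0 1"
  then obtain x where x: "x \<in> ball 0 1" "w = f x" by blast
  define u where "u = midpoint x z"
  have u: "u \<in> ball 0 1"
    using x z norm_triangle_ineq[of x z] by (simp add: u_def midpoint_def)
  have ne: "u \<noteq> x" using x z by (auto simp: u_def midpoint_eq_endpoint)
  have "z - u = u - x" by (simp add: u_def midpoint_def algebra_simps flip: scaleR_2)
  then have "(f u - f x) \<bullet> (u - x) \<le> 0"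
    using minty_setD[OF w u] x by (simp add: inner_simps)
  with strictly_monotone_onD[OF mono u x(1) ne] show False by simp
qed

lemma minty_set_midpoint:
  assumes "w \<in> minty_set S f x" "w \<in> minty_set S f y"
  shows "w \<in> minty_set S f (midpoint x y)"
proof -
  have "(w - f u) \<bullet> (midpoint x y - u) = ((w - f u) \<bullet> (x - u) + (w - f u) \<bullet> (y - u)) / 2" for u
    by (simp add: midpoint_def inner_simps field_simps)
  with assms show ?thesis by (auto simp: minty_set_def simp del: eq_divide_eq_numeral1)
qed

text \<open>Strict convexity of the ball, from the parallelogram law.\<close>

lemma norm_midpoint_less:
  fixes x y :: "'a::real_inner"
  assumes "norm x = 1" "norm y = 1" "x \<noteq> y"
  shows "norm (midpoint x y) < 1"
proof -
  have "(norm (x + y))\<^sup>2 + (norm (x - y))\<^sup>2 = 4"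
    using assms by (simp add: power2_norm_eq_inner inner_simps norm_eq_1)
  moreover have "norm (x - y) > 0" using assms by simp
  then have "(norm (x - y))\<^sup>2 > 0" by (rule zero_less_power)
  ultimately have "(norm (x + y))\<^sup>2 < 2\<^sup>2" unfolding power2_eq_square[of 2] by linarith
  then have "norm (x + y) < 2" by (rule power_less_imp_less_base) simp
  then show ?thesis by (simp add: midpoint_def)
qed

text \<open>A common \<open>w\<close> would also belong to the set of the midpoint, which is
  interior if \<open>x \<noteq> y\<close>. Then \<open>w\<close> would be a value of
  \<open>f\<close>, which is excluded for boundary points.\<close>

lemma minty_set_boundary_disjoint:
  fixes f :: "'a::euclidean_space \<Rightarrow> 'a"
  assumes cont: "continuous_on (ball 0 1) f" and mono: "strictly_monotone_on (ball 0 1) f"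
    and "norm x = 1" "norm y = 1" "w \<in> minty_set (ball 0 1) f x" "w \<in> minty_set (ball 0 1) f y"
  shows "x = y"
proof (rule ccontr)
  assume "x \<noteq> y"
  then have m: "midpoint x y \<in> ball 0 1"
    using norm_midpoint_less assms by auto
  have "w = f (midpoint x y)"
    by (rule minty_set_interior[OF cont _ m minty_set_midpoint]) (use assms in auto)
  with m minty_set_boundary_disjoint_image[OF mono] assms show False by blast
qed

section \<open>Half lines in the Minty sets of boundary points\<close>

lemma inner_diff_ball_pos:
  fixes z u :: "'a::real_inner"
  assumes "norm z = 1" "norm u < 1"
  shows "z \<bullet> (z - u) > 0"
proof -
  have "z \<bullet> u \<le> norm z * norm u" by (rule norm_cauchy_schwarz)
  with assms show ?thesis by (simp add: inner_simps dot_square_norm)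
qed

lemma minty_set_ray:
  assumes "norm z = 1" "w \<in> minty_set (ball 0 1) f z" "t \<ge> 0"
  shows "w + t *\<^sub>R z \<in> minty_set (ball 0 1) f z"
proof -
  have "(w + t *\<^sub>R z - f u) \<bullet> (z - u) \<ge> 0" if "u \<in> ball 0 1" for u
  proof -
    have "(w + t *\<^sub>R z - f u) \<bullet> (z - u) = (w - f u) \<bullet> (z - u) + t * (z \<bullet> (z - u))"
      by (simp add: inner_simps algebra_simps)
    moreover have "z \<bullet> (z - u) > 0" using that assms by (intro inner_diff_ball_pos) auto
    moreover have "(w - f u) \<bullet> (z - u) \<ge> 0" using minty_setD that assms by blast
    ultimately show ?thesis using \<open>t \<ge> 0\<close> by simp
  qed
  then show ?thesis by (simp add: minty_set_def)
qed

text \<open>The parameters \<open>t\<close> with \<open>w + t z\<close> in the set are closed and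
  upward closed, and bounded below by the single constraint \<open>u = 0\<close>. Hence they form
  \<open>[Inf T, \<infinity>)\<close>, whose least element gives the end point
  \<open>a\<close>.\<close>

lemma minty_set_slice:
  assumes z: "norm z = 1" and w: "w \<in> minty_set (ball 0 1) f z"
  obtains a where "{p \<in> minty_set (ball 0 1) f z. \<exists>t. p = w + t *\<^sub>R z} = {a + t *\<^sub>R z | t. t \<ge> 0}"
proof -
  define M where "M = minty_set (ball 0 1) f z"
  define T where "T = {t. w + t *\<^sub>R z \<in> M}"
  have "T = (\<Inter>u\<in>ball 0 1. {t. 0 \<le> (w + t *\<^sub>R z - f u) \<bullet> (z - u)})"
    by (auto simp: T_def M_def minty_set_def)
  also have "closed \<dots>"
    by (intro closed_INT ballI closed_Collect_le continuous_intros)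
  finally have closed: "closed T" .
  have T0: "0 \<in> T" using w by (simp add: T_def M_def)
  have up: "t' \<in> T" if "t \<in> T" "t \<le> t'" for t t'
  proof -
    have "w + t *\<^sub>R z + (t' - t) *\<^sub>R z \<in> M"
      unfolding M_def by (rule minty_set_ray) (use that z in \<open>auto simp: T_def M_def\<close>)
    then show ?thesis by (simp add: T_def algebra_simps)
  qed
  have bdd: "bdd_below T"
  proof (rule bdd_belowI)
    fix t assume "t \<in> T"
    then have "(w + t *\<^sub>R z - f 0) \<bullet> (z - 0) \<ge> 0"
      unfolding T_def M_def using minty_setD[of _ "ball 0 1" f z 0] by auto
    then show "- ((w - f 0) \<bullet> z) \<le> t"
      using z by (simp add: inner_simps dot_square_norm)
  qed
  have "Inf T \<in> T" using closed_contains_Inf[OF _ bdd closed] T0 by blast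
  then have T_eq: "t \<in> T \<longleftrightarrow> Inf T \<le> t" for t
    using up cInf_lower[OF _ bdd] by blast
  define a where "a = w + Inf T *\<^sub>R z"
  have "{p \<in> M. \<exists>t. p = w + t *\<^sub>R z} = {w + t *\<^sub>R z | t. t \<in> T}"
    by (auto simp: T_def)
  also have "\<dots> = {a + t *\<^sub>R z | t. t \<ge> 0}"
  proof (intro set_eqI iffI)
    fix p assume "p \<in> {w + t *\<^sub>R z | t. t \<in> T}"
    then obtain t where "p = w + t *\<^sub>R z" "Inf T \<le> t" using T_eq by auto
    then have "p = a + (t - Inf T) *\<^sub>R z" "t - Inf T \<ge> 0" by (auto simp: a_def algebra_simps)
    then show "p \<in> {a + t *\<^sub>R z | t. t \<ge> 0}" by blast
  next
    fix p assume "p \<in> {a + t *\<^sub>R z | t. t \<ge> 0}"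
    then obtain t where t: "p = a + t *\<^sub>R z" "t \<ge> 0" by blast
    then have "p = w + (Inf T + t) *\<^sub>R z" "Inf T + t \<in> T" by (auto simp: a_def algebra_simps T_eq)
    then show "p \<in> {w + t *\<^sub>R z | t. t \<in> T}" by blast
  qed
  finally show thesis using that by (simp add: M_def)
qed

theorem close_to_convex_domain_strictly_monotone_image:
  assumes cont: "continuous_on unit_disk f" and mono: "strictly_monotone_on unit_disk f"
  shows "close_to_convex_domain (f ` unit_disk)"
proof -
  define M where "M = minty_set unit_disk f"
  \<comment> \<open>A Minty set may be wider than one half line, so it is cut along all lines
    parallel to \<open>z\<close>. Different \<open>w\<close> on one such line yield the same slice,
    hence one member of the family.\<close>
  define line where "line z w = {p \<in> M z. \<exists>t. p = w + t *\<^sub>R z}" for z w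
  define \<L> where "\<L> = {line z w | z w. norm z = 1 \<and> w \<in> M z}"
  have "half_line L" if "L \<in> \<L>" for L
  proof -
    obtain z w where zw: "L = line z w" "norm z = 1" "w \<in> M z" using \<open>L \<in> \<L>\<close> by (auto simp: \<L>_def)
    then obtain a where "L = {a + t *\<^sub>R z | t. t \<ge> 0}"
      using minty_set_slice[of z w f] by (auto simp: line_def M_def)
    moreover have "z \<noteq> 0" using zw by auto
    ultimately show ?thesis by (auto simp: half_line_def scaleR_conv_of_real)
  qed
  moreover have "pairwise disjnt \<L>"
  proof (rule pairwiseI, rule ccontr)
    fix L L' assume "L \<in> \<L>" "L' \<in> \<L>" and ne: "L \<noteq> L'" and "\<not> disjnt L L'"
    then obtain z w z' w' p where
      L: "L = line z w" "norm z = 1" "L' = line z' w'" "norm z' = 1" and p: "p \<in> L" "p \<in> L'"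
      unfolding \<L>_def disjnt_iff by blast
    \<comment> \<open>A common point \<open>p\<close> lies in the Minty sets of both
      \<open>z\<close> and \<open>z'\<close>, which forces the directions to agree. Both slices are
      then the slice through \<open>p\<close>.\<close>
    have "z' = z"
      by (rule minty_set_boundary_disjoint[OF cont mono, of _ _ p])
        (use L p in \<open>auto simp: line_def M_def\<close>)
    moreover have "line z v = line z p" if v: "p \<in> line z v" for v
    proof -
      obtain s where s: "p = v + s *\<^sub>R z" using v unfolding line_def by blast
      have "(\<exists>t. q = v + t *\<^sub>R z) \<longleftrightarrow> (\<exists>t. q = p + t *\<^sub>R z)" for q
      proof
        assume "\<exists>t. q = v + t *\<^sub>R z"
        then obtain t where "q = v + t *\<^sub>R z" ..
        then have "q = p + (t - s) *\<^sub>R z" by (simp add: s algebra_simps)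
        then show "\<exists>t. q = p + t *\<^sub>R z" ..
      next
        assume "\<exists>t. q = p + t *\<^sub>R z"
        then obtain t where "q = p + t *\<^sub>R z" ..
        then have "q = v + (t + s) *\<^sub>R z" by (simp add: s algebra_simps)
        then show "\<exists>t. q = v + t *\<^sub>R z" ..
      qed
      then show ?thesis by (simp add: line_def)
    qed
    ultimately have "L = L'" using L p by metis
    with ne show False ..
  qed
  moreover have "- (f ` unit_disk) = \<Union>\<L>"
  proof (intro set_eqI iffI)
    fix w assume w: "w \<in> - (f ` unit_disk)"
    obtain z where z: "z \<in> cball 0 1" "w \<in> M z"
      using minty_set_surj[OF cont mono, of w] by (auto simp: M_def)
    have "z \<notin> unit_disk"
      using minty_set_interior[OF cont open_ball, of z w] z w by (auto simp: M_def)
    with z have "norm z = 1" by auto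
    moreover have "w \<in> line z w" using z by (auto simp: line_def intro: exI[of _ 0])
    ultimately show "w \<in> \<Union>\<L>" using z by (auto simp: \<L>_def)
  next
    fix w assume "w \<in> \<Union>\<L>"
    then obtain z where "norm z = 1" "w \<in> M z" by (auto simp: \<L>_def line_def)
    then show "w \<in> - (f ` unit_disk)"
      using minty_set_boundary_disjoint_image[OF mono] by (simp add: M_def)
  qed
  moreover have "open (f ` unit_disk)"
    using invariance_of_domain[OF cont open_ball strictly_monotone_on_imp_inj_on[OF mono]] .
  moreover have "connected (f ` unit_disk)"
    by (rule connected_continuous_image[OF cont]) simp
  ultimately show ?thesis
    unfolding close_to_convex_domain_def by (intro conjI exI[of _ \<L>]) auto
qed

section \<open>From the class condition to a pointwise bound on the derivatives\<close>

text \<open>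
  The integrating factor \<open>t powr (1 / \<alpha>)\<close> turns \<open>Re (p + \<alpha> z p')\<close> on the ray through \<open>z\<close> into a
  derivative.
\<close>
lemma Re_pos_of_Re_add_deriv_pos:
  assumes \<alpha>: "\<alpha> \<ge> 0" and p: "p holomorphic_on unit_disk"
    and pos: "\<And>z. z \<in> unit_disk \<Longrightarrow> Re (p z + of_real \<alpha> * z * deriv p z) > 0"
    and z: "z \<in> unit_disk"
  shows "Re (p z) > 0"
proof (cases "\<alpha> = 0")
  case True
  then show ?thesis using pos[OF z] by simp
next
  case False
  with \<alpha> have \<alpha>: "\<alpha> > 0" by simp
  define \<phi> where "\<phi> t = t powr (1 / \<alpha>) * Re (p (of_real t * z))" for t :: real
  have tz: "of_real t * z \<in> unit_disk" if "0 \<le> t" "t \<le> 1" for t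
    using that z mult_left_le_one_le[of "norm z" t] by (simp add: norm_mult)
  have "continuous_on ((\<lambda>t. of_real t * z) ` {0..1::real}) p"
    by (rule continuous_on_subset[OF holomorphic_on_imp_continuous_on[OF p]]) (use tz in auto)
  then have "continuous_on {0..1} (\<lambda>t::real. p (of_real t * z))"
    by (rule continuous_on_compose2) (auto intro!: continuous_intros)
  then have cont: "continuous_on {0..1} \<phi>"
    unfolding \<phi>_def using \<alpha> by (intro continuous_intros continuous_on_powr') auto
  \<comment> \<open>Here \<open>\<phi> 0 = 0\<close> and \<open>\<phi> 1 = Re (p z)\<close>. The
    power may fail to be differentiable at 0, so the derivative is used only on the open interval,
    with continuity at the ends.\<close>
  have "\<phi> 0 < \<phi> 1"
  proof (rule DERIV_pos_imp_increasing_open[OF _ _ cont])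
    fix t :: real assume t: "0 < t" "t < 1"
    define u where "u = of_real t * z"
    have u: "u \<in> unit_disk" using tz t by (simp add: u_def)
    have "(p has_field_derivative deriv p u) (at u)"
      using holomorphic_derivI[OF p open_ball u] .
    moreover have "((\<lambda>s. of_real s * z) has_vector_derivative z) (at t)"
      by (auto intro!: derivative_eq_intros)
    ultimately have "((p \<circ> (\<lambda>s. of_real s * z)) has_vector_derivative z * deriv p u) (at t)"
      unfolding u_def by (intro field_vector_diff_chain_at)
    then have "((\<lambda>s. Re (p (of_real s * z))) has_real_derivative Re (z * deriv p u)) (at t)"
      unfolding o_def has_real_derivative_iff_has_vector_derivative
      by (rule bounded_linear.has_vector_derivative[OF bounded_linear_Re])
    moreover have "((\<lambda>s. s powr (1 / \<alpha>)) has_real_derivative (1 / \<alpha>) * t powr (1 / \<alpha> - 1)) (at t)"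
      using t by (intro has_real_derivative_powr) auto
    ultimately have "(\<phi> has_real_derivative
        (1 / \<alpha>) * t powr (1 / \<alpha> - 1) * Re (p u) + Re (z * deriv p u) * t powr (1 / \<alpha>)) (at t)"
      unfolding \<phi>_def u_def by (rule DERIV_mult[rotated])
    moreover have "t powr (1 / \<alpha>) = t powr (1 / \<alpha> - 1) * t"
      using t by (simp add: powr_diff)
    then have "(1 / \<alpha>) * t powr (1 / \<alpha> - 1) * Re (p u) + Re (z * deriv p u) * t powr (1 / \<alpha>) =
        (1 / \<alpha>) * t powr (1 / \<alpha> - 1) * Re (p u + of_real \<alpha> * u * deriv p u)"
      using \<alpha> by (simp add: u_def field_simps)
    moreover have "\<dots> > 0" using t \<alpha> pos[OF u] by simp
    ultimately show "\<exists>y. (\<phi> has_real_derivative y) (at t) \<and> 0 < y" by metis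
  qed simp
  then show ?thesis using \<alpha> by (simp add: \<phi>_def)
qed

text \<open>For fixed \<open>z\<close>, choose a unimodular \<open>e\<close> with
  \<open>e * deriv g z = - |deriv g z|\<close>. The hypothesis makes \<open>p = h' + e g'\<close>
  satisfy the positivity condition on the whole disk, and \<open>Re (p z) > 0\<close> is the
  claim.\<close>

lemma norm_deriv_less_Re_deriv:
  assumes "\<alpha> \<ge> 0" and h: "h holomorphic_on unit_disk" and g: "g holomorphic_on unit_disk"
    and ineq: "\<And>z. z \<in> unit_disk \<Longrightarrow>
      Re (deriv h z + of_real \<alpha> * z * deriv (deriv h) z) >
      cmod (deriv g z + of_real \<alpha> * z * deriv (deriv g) z)"
    and z: "z \<in> unit_disk"
  shows "cmod (deriv g z) < Re (deriv h z)"
proof -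
  obtain e where e: "cmod e = 1" "e * deriv g z = - of_real (cmod (deriv g z))"
  proof (cases "deriv g z = 0")
    case True
    then show ?thesis using that[of 1] by simp
  next
    case False
    then show ?thesis
      using that[of "- of_real (cmod (deriv g z)) / deriv g z"] by (simp add: norm_divide)
  qed
  define p where "p x = deriv h x + e * deriv g x" for x
  have h': "deriv h holomorphic_on unit_disk" and g': "deriv g holomorphic_on unit_disk"
    by (intro holomorphic_deriv h g open_ball)+
  have "Re (p z) > 0"
  proof (rule Re_pos_of_Re_add_deriv_pos[OF \<open>\<alpha> \<ge> 0\<close> _ _ z])
    show "p holomorphic_on unit_disk"
      unfolding p_def
      by (intro holomorphic_on_add holomorphic_on_mult holomorphic_on_const h' g')
    fix x assume x: "x \<in> unit_disk"
    have "(p has_field_derivative deriv (deriv h) x + e * deriv (deriv g) x) (at x)"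
      unfolding p_def
      by (intro DERIV_add DERIV_cmult holomorphic_derivI[OF h' _ x] holomorphic_derivI[OF g' _ x]) auto
    then have "deriv p x = deriv (deriv h) x + e * deriv (deriv g) x"
      by (rule DERIV_imp_deriv)
    then have "p x + of_real \<alpha> * x * deriv p x =
        (deriv h x + of_real \<alpha> * x * deriv (deriv h) x) +
        e * (deriv g x + of_real \<alpha> * x * deriv (deriv g) x)"
      by (simp add: p_def algebra_simps)
    moreover have "\<bar>Re (e * (deriv g x + of_real \<alpha> * x * deriv (deriv g) x))\<bar> \<le>
        cmod (deriv g x + of_real \<alpha> * x * deriv (deriv g) x)"
      using abs_Re_le_cmod e(1) by (metis mult_1 norm_mult)
    ultimately show "Re (p x + of_real \<alpha> * x * deriv p x) > 0"
      using ineq[OF x] by simp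
  qed
  with e show ?thesis by (simp add: p_def)
qed

section \<open>Monotonicity of harmonic maps and derivatives at the origin\<close>

text \<open>Used twice: along chords for monotonicity, and in the directions 1 and
  \<open>\<i>\<close> at 0 for the partial derivatives.\<close>

lemma has_vector_derivative_harmonic_line:
  assumes h: "h holomorphic_on S" and g: "g holomorphic_on S" and "open S"
    and z: "x + of_real t * d \<in> S"
  shows "((\<lambda>t. h (x + of_real t * d) + cnj (g (x + of_real t * d))) has_vector_derivative
    (d * deriv h (x + of_real t * d) + cnj (d * deriv g (x + of_real t * d)))) (at t)"
proof -
  have line: "((\<lambda>t. x + of_real t * d) has_vector_derivative d) (at t)"
    by (auto intro!: derivative_eq_intros)
  have "((\<lambda>t. k (x + of_real t * d)) has_vector_derivative d * deriv k (x + of_real t * d)) (at t)"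
    if "k holomorphic_on S" for k
    using field_vector_diff_chain_at[OF line holomorphic_derivI[OF that \<open>open S\<close> z]] by (simp add: o_def)
  from this[OF h] this[OF g] show ?thesis
    by (intro has_vector_derivative_add has_vector_derivative_cnj)
qed

text \<open>A harmonic form of the Noshiro-Warschawski argument: along a chord with direction
  \<open>d\<close>, the derivative of \<open>f \<bullet> d\<close> is at least
  \<open>|d|^2 (Re h' - |g'|) > 0\<close>.\<close>

lemma harmonic_strictly_monotone_on:
  assumes h: "h holomorphic_on S" and g: "g holomorphic_on S" and "open S" "convex S"
    and less: "\<And>z. z \<in> S \<Longrightarrow> cmod (deriv g z) < Re (deriv h z)"
  shows "strictly_monotone_on S (\<lambda>z. h z + cnj (g z))"
  unfolding strictly_monotone_on_def
proof (intro ballI impI)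
  fix y x assume xy: "y \<in> S" "x \<in> S" "y \<noteq> x"
  define d where "d = y - x"
  have "d \<noteq> 0" using xy by (simp add: d_def)
  define \<gamma> where "\<gamma> t = x + of_real t * d" for t :: real
  define \<phi> where "\<phi> t = (h (\<gamma> t) + cnj (g (\<gamma> t))) \<bullet> d" for t
  have in_S: "\<gamma> t \<in> S" if "0 \<le> t" "t \<le> 1" for t
  proof -
    have "\<gamma> t = (1 - t) *\<^sub>R x + t *\<^sub>R y"
      by (simp add: \<gamma>_def d_def scaleR_conv_of_real algebra_simps)
    with convexD_alt[OF \<open>convex S\<close> xy(2,1) that] show ?thesis by simp
  qed
  have "\<phi> 0 < \<phi> 1"
  proof (rule DERIV_pos_imp_increasing[of 0 1 \<phi>])
    fix t :: real assume "0 \<le> t" "t \<le> 1"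
    note u = in_S[OF this]
    let ?D = "d * deriv h (\<gamma> t) + cnj (d * deriv g (\<gamma> t))"
    have "(\<phi> has_real_derivative ?D \<bullet> d) (at t)"
      unfolding \<phi>_def \<gamma>_def has_real_derivative_iff_has_vector_derivative
      by (intro bounded_linear.has_vector_derivative[OF bounded_linear_inner_left]
          has_vector_derivative_harmonic_line[OF h g \<open>open S\<close>]) (use u in \<open>simp add: \<gamma>_def\<close>)
    moreover have "?D \<bullet> d > 0"
    proof -
      have "(d * deriv h (\<gamma> t)) \<bullet> d = (cmod d)\<^sup>2 * Re (deriv h (\<gamma> t))"
        unfolding cmod_power2 by (simp add: inner_complex_def algebra_simps power2_eq_square)
      moreover have "\<bar>cnj (d * deriv g (\<gamma> t)) \<bullet> d\<bar> \<le> (cmod d)\<^sup>2 * cmod (deriv g (\<gamma> t))"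
        using Cauchy_Schwarz_ineq2[of "cnj (d * deriv g (\<gamma> t))" d]
        by (simp add: norm_mult power2_eq_square mult_ac)
      moreover have "(cmod d)\<^sup>2 * cmod (deriv g (\<gamma> t)) < (cmod d)\<^sup>2 * Re (deriv h (\<gamma> t))"
        using less[OF u] \<open>d \<noteq> 0\<close> by simp
      ultimately show ?thesis by (simp only: inner_add_left)
    qed
    ultimately show "\<exists>y. (\<phi> has_real_derivative y) (at t) \<and> 0 < y" by blast
  qed simp
  then show "(h y + cnj (g y) - (h x + cnj (g x))) \<bullet> (y - x) > 0"
    by (simp add: \<phi>_def \<gamma>_def d_def inner_diff_left)
qed

text \<open>The partial derivatives at 0 are \<open>h' + cnj g'\<close> and
  \<open>\<i> (h' - cnj g')\<close>, so \<open>h'\<close> cancels in the combination.\<close>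

lemma wirtinger_bar_canonical_rep:
  assumes "canonical_rep f h g"
  shows "wirtinger_bar f 0 = cnj (deriv g 0)"
proof -
  from assms have h: "h holomorphic_on unit_disk" and g: "g holomorphic_on unit_disk"
    and f: "\<And>z. z \<in> unit_disk \<Longrightarrow> f z = h z + cnj (g z)"
    by (auto simp: canonical_rep_def)
  have deriv: "vector_derivative (\<lambda>t. f (of_real t * d)) (at 0) = d * deriv h 0 + cnj (d * deriv g 0)"
    if d: "cmod d = 1" for d
  proof (rule vector_derivative_at)
    have "((\<lambda>t. h (of_real t * d) + cnj (g (of_real t * d))) has_vector_derivative
        d * deriv h 0 + cnj (d * deriv g 0)) (at 0)"
      using has_vector_derivative_harmonic_line[OF h g open_ball, of 0 0 d] by simp
    then show "((\<lambda>t. f (of_real t * d)) has_vector_derivative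
        d * deriv h 0 + cnj (d * deriv g 0)) (at 0)"
      \<comment> \<open>Here \<open>ball 0 1\<close> is the real interval of parameters; as
        \<open>|d| = 1\<close>, it keeps \<open>t d\<close> in the disk, where \<open>f\<close>
        equals \<open>h + cnj g\<close>.\<close>
      by (rule has_vector_derivative_transform_within_open[of _ _ _ "ball 0 1"])
        (use f d in \<open>auto simp: norm_mult\<close>)
  qed
  show ?thesis
    using deriv[of 1] deriv[of \<i>]
    by (simp add: wirtinger_bar_def partial_x_def partial_y_def mult.commute[of _ \<i>] ring_distribs)
qed

theorem mainTheorem1:
  fixes \<alpha> :: real
  assumes "\<alpha> \<ge> 0"
  shows "class_W0 \<alpha> \<subseteq> class_C0"
proof
  fix f assume "f \<in> class_W0 \<alpha>"
  then obtain h g where f: "f \<in> class_H" and rep: "canonical_rep f h g" and g0: "deriv g 0 = 0"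
    and ineq: "\<And>z. z \<in> unit_disk \<Longrightarrow>
      Re (deriv h z + of_real \<alpha> * z * deriv (deriv h) z) >
      cmod (deriv g z + of_real \<alpha> * z * deriv (deriv g) z)"
    unfolding class_W0_def by blast
  from rep have h: "h holomorphic_on unit_disk" and g: "g holomorphic_on unit_disk"
    and f_eq: "\<And>z. z \<in> unit_disk \<Longrightarrow> f z = h z + cnj (g z)"
    by (auto simp: canonical_rep_def)
  have "strictly_monotone_on unit_disk (\<lambda>z. h z + cnj (g z))"
    by (intro harmonic_strictly_monotone_on h g open_ball convex_ball
        norm_deriv_less_Re_deriv[OF assms h g ineq])
  moreover have "continuous_on unit_disk (\<lambda>z. h z + cnj (g z))"
    by (intro continuous_intros holomorphic_on_imp_continuous_on h g)
  ultimately have "close_to_convex_domain ((\<lambda>z. h z + cnj (g z)) ` unit_disk)"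
    by (rule close_to_convex_domain_strictly_monotone_image[rotated])
  \<comment> \<open>The two functions are known to agree only on the disk, so the images are
    identified rather than the functions.\<close>
  also have "(\<lambda>z. h z + cnj (g z)) ` unit_disk = f ` unit_disk"
    using f_eq by (intro image_cong) auto
  finally show "f \<in> class_C0"
    using f wirtinger_bar_canonical_rep[OF rep] g0 by (simp add: class_C0_def close_to_convex_def)
qed

end
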